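(* For every integer $s\ge 1$, one has $f_{2}(2,s,s) > s^{2}$.
   Context: An $s$-convex set in $\mathbb{R}^d$ is a union of $s$ convex sets. For integers $d\ge 1$, $r\ge 2$ and $s_1,\dots,s_r\ge 1$, $f_r(d,s_1,\ldots,s_r)$ denotes the least integer $n$ such that every $n$-point set $P\subseteq\mathbb{R}^d$ admits a partition $P=P_1\sqcup\cdots\sqcup P_r$ with the property that for every choice of $s_i$-convex sets $C_i\supseteq P_i$ ($i\in[r]$) one necessarily has $\bigcap_{i=1}^r C_i\neq\emptyset$. *)

theory Defs
  imports "HOL-Analysis.Analysis"
begin

text \<open>The convex sets need not be distinct, disjoint or nonempty.\<close>
definition s_convex :: "nat \<Rightarrow> 'a::real_vector set \<Rightarrow> bool" where
  "s_convex s S \<longleftrightarrow> (\<exists>K. (\<forall>i<s. convex (K i)) \<and> S = (\<Union>i<s. K i))"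

text \<open>A partition of \<open>P\<close> into \<open>r = length ss\<close> labelled parts \<open>Q 0, \<dots>, Q (r - 1)\<close> such that
  any \<open>ss ! i\<close>-convex sets containing the parts \<open>Q i\<close> have a common point. Nonemptiness of the
  parts is not demanded separately: the empty set is \<open>s\<close>-convex, so an empty part violates the
  last condition.\<close>
definition tverberg_partition ::
    "nat list \<Rightarrow> 'a::real_vector set \<Rightarrow> (nat \<Rightarrow> 'a set) \<Rightarrow> bool" where
  "tverberg_partition ss P Q \<longleftrightarrow>
     disjoint_family_on Q {..<length ss} \<and>
     (\<Union>i<length ss. Q i) = P \<and>
     (\<forall>C. (\<forall>i<length ss. s_convex (ss ! i) (C i) \<and> Q i \<subseteq> C i)
            \<longrightarrow> (\<Inter>i<length ss. C i) \<noteq> {})"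

text \<open>\<open>tverberg_number TYPE('d) [s\<^sub>1, \<dots>, s\<^sub>r]\<close> is $f_r(d, s_1, \ldots, s_r)$ for \<open>d = CARD('d)\<close>.
  If no \<open>n\<close> had the required property, \<open>LEAST\<close> would be an unspecified number; hence a lower bound
  on this quantity also requires showing that some \<open>n\<close> has the property.\<close>
definition tverberg_number :: "'d::finite itself \<Rightarrow> nat list \<Rightarrow> nat" where
  "tverberg_number _ ss =
     (LEAST n. \<forall>P :: (real ^ 'd) set. finite P \<and> card P = n
                 \<longrightarrow> (\<exists>Q. tverberg_partition ss P Q))"

end

theory Submission
  imports Defs "HOL-Real_Asymp.Real_Asymp"
begin

text \<open>
  Lower bound. Place \<open>s\<^sup>2\<close> points \<open>p i j\<close> so that some line through \<open>p i j\<close> has the rest of row \<open>i\<close>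
  strictly on one side and the rest of column \<open>j\<close> strictly on the other. The hulls of any part of
  row \<open>i\<close> and any disjoint part of column \<open>j\<close> are then disjoint. Hence, for every colouring of the
  points in red and blue, the red parts of the rows and the blue parts of the columns have hulls
  whose two unions do not meet.

  Finiteness. If a partition \<open>(A, P - A)\<close> violates the Tverberg property, then \<open>A\<close> is a fixed
  Boolean combination of \<open>s\<^sup>2\<close> traces of halfspaces on \<open>P\<close>. By Radon's theorem halfspaces shatter no
  set of \<open>DIM + 2\<close> points, so by the Sauer--Shelah bound there are only polynomially many such
  combinations, fewer than the \<open>2\<^sup>n\<close> subsets of \<open>P\<close> when \<open>n\<close> is large.
\<close>

section \<open>Shattered sets\<close>

definition shatters :: "'a set set \<Rightarrow> 'a set \<Rightarrow> bool" where
  "shatters F S \<longleftrightarrow> (\<forall>T\<subseteq>S. \<exists>A\<in>F. A \<inter> S = T)"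

text \<open>Pajor's lemma, by induction on the ground set: deleting \<open>x\<close> turns
  \<open>F\<close> into the projection \<open>F0\<close>, while \<open>F1\<close> records the sets
  that occur both with and without \<open>x\<close>. What \<open>F0\<close> shatters is shattered by
  \<open>F\<close>, and what \<open>F1\<close> shatters stays shattered by \<open>F\<close> after
  adding \<open>x\<close>.\<close>

lemma card_le_card_shattered:
  assumes "finite X" "F \<subseteq> Pow X"
  shows "card F \<le> card {S. S \<subseteq> X \<and> shatters F S}"
  using assms
proof (induction X arbitrary: F rule: finite_induct)
  case empty
  then have "F = {} \<or> F = {{}}" by (simp add: subset_singleton_iff)
  moreover have "{S. S \<subseteq> {} \<and> shatters {{}} S} = {{} :: 'a set}"
    by (auto simp: shatters_def)
  ultimately show ?case by (elim disjE) (simp_all only: card.empty le0 order_refl)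
next
  case (insert x X)
  have finF: "finite F"
    using insert.prems insert.hyps finite_subset[of F "Pow (insert x X)"] by simp
  define F0 where "F0 = {A. x \<notin> A \<and> (A \<in> F \<or> insert x A \<in> F)}"
  define F1 where "F1 = {A. x \<notin> A \<and> A \<in> F \<and> insert x A \<in> F}"
  define S0 where "S0 = {S. S \<subseteq> X \<and> shatters F0 S}"
  define S1 where "S1 = {S. S \<subseteq> X \<and> shatters F1 S}"
  have sub: "F0 \<subseteq> Pow X" "F1 \<subseteq> Pow X"
    using insert.prems by (auto simp: F0_def F1_def)
  have fin: "finite F0" "finite F1" "finite S0" "finite S1"
    using sub insert.hyps by (auto simp: S0_def S1_def intro: finite_subset[OF _ finite_Pow_iff[THEN iffD2]])
  let ?out = "{A\<in>F. x \<notin> A}" and ?in = "(\<lambda>A. A - {x}) ` {A\<in>F. x \<in> A}"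
  have in_eq: "?in = {A. x \<notin> A \<and> insert x A \<in> F}"
  proof (intro equalityI subsetI)
    fix A assume "A \<in> {A. x \<notin> A \<and> insert x A \<in> F}"
    then show "A \<in> ?in"
      by (intro image_eqI[of _ _ "insert x A"]) auto
  qed (auto simp: insert_absorb)
  \<comment> \<open>Deleting \<open>x\<close> merges exactly the pairs counted by \<open>F1\<close>,
    so inclusion-exclusion yields \<open>card F = card F0 + card F1\<close>.\<close>
  have "F0 = ?out \<union> ?in" "F1 = ?out \<inter> ?in"
    unfolding in_eq by (auto simp: F0_def F1_def)
  then have "card F0 + card F1 = card ?out + card ?in"
    using finF card_Un_Int[of ?out ?in] by simp
  moreover have "card ?in = card {A\<in>F. x \<in> A}"
    by (intro card_image inj_onI) (metis (no_types, lifting) insert_Diff mem_Collect_eq)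
  moreover have "card ?out + card {A\<in>F. x \<in> A} = card F"
  proof -
    have "?out \<union> {A\<in>F. x \<in> A} = F" "?out \<inter> {A\<in>F. x \<in> A} = {}" by blast+
    then show ?thesis using finF card_Un_disjoint[of ?out "{A\<in>F. x \<in> A}"] by simp
  qed
  ultimately have cardF: "card F = card F0 + card F1" by simp

  have shat0: "shatters F S" if S: "S \<in> S0" for S
    unfolding shatters_def
  proof (intro allI impI)
    fix T assume "T \<subseteq> S"
    then obtain A where A: "A \<in> F0" "A \<inter> S = T"
      using S unfolding S0_def shatters_def by blast
    moreover have "insert x A \<inter> S = A \<inter> S"
      using S insert.hyps by (auto simp: S0_def)
    ultimately show "\<exists>A\<in>F. A \<inter> S = T"
      unfolding F0_def by auto
  qed
  have shat1: "shatters F (insert x S)" if S: "S \<in> S1" for S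
    unfolding shatters_def
  proof (intro allI impI)
    fix T assume T: "T \<subseteq> insert x S"
    then have "T - {x} \<subseteq> S" by blast
    then obtain A where A: "A \<in> F1" "A \<inter> S = T - {x}"
      using S unfolding S1_def shatters_def by blast
    from A(1) have F: "x \<notin> A" "A \<in> F" "insert x A \<in> F" by (simp_all add: F1_def)
    show "\<exists>A\<in>F. A \<inter> insert x S = T"
    proof (cases "x \<in> T")
      case True
      then have "insert x A \<inter> insert x S = T" using A(2) by blast
      then show ?thesis using F(3) by (rule bexI)
    next
      case False
      then have "A \<inter> insert x S = T" using A(2) F(1) by simp
      then show ?thesis using F(2) by (rule bexI)
    qed
  qed
  have xS: "x \<notin> S" if "S \<in> S0 \<or> S \<in> S1" for S
    using that insert.hyps by (auto simp: S0_def S1_def)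
  have "card F \<le> card S0 + card S1"
    using cardF insert.IH[OF sub(1)] insert.IH[OF sub(2)] by (simp add: S0_def S1_def)
  also have "card S1 = card (insert x ` S1)"
    using xS by (intro card_image[symmetric] inj_onI) (metis insert_ident)
  also have "card S0 + card (insert x ` S1) = card (S0 \<union> insert x ` S1)"
    using xS fin by (intro card_Un_disjoint[symmetric]) auto
  also have "\<dots> \<le> card {S. S \<subseteq> insert x X \<and> shatters F S}"
    using shat0 shat1 insert.hyps by (intro card_mono) (auto simp: S0_def S1_def)
  finally show ?case .
qed

lemma card_subsets_card_le:
  assumes "finite X"
  shows "card {S. S \<subseteq> X \<and> card S \<le> k} \<le> (card X + 1) ^ k"
proof -
  let ?n = "card X"
  have "{S. S \<subseteq> X \<and> card S \<le> k} = (\<Union>i\<le>k. {S. S \<subseteq> X \<and> card S = i})" by auto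
  then have "card {S. S \<subseteq> X \<and> card S \<le> k} \<le> (\<Sum>i\<le>k. card {S. S \<subseteq> X \<and> card S = i})"
    by (simp add: card_UN_le)
  \<comment> \<open>The factor \<open>k choose i\<close> is at least 1 and completes the sum to the
    binomial expansion of \<open>(?n + 1) ^ k\<close>.\<close>
  also have "\<dots> \<le> (\<Sum>i\<le>k. (k choose i) * ?n ^ i)"
  proof (rule sum_mono)
    fix i assume "i \<in> {..k}"
    then have "1 \<le> k choose i" by (simp add: Suc_leI)
    moreover have "?n choose i \<le> ?n ^ i"
      by (cases "i \<le> ?n") (simp_all add: binomial_le_pow binomial_eq_0)
    ultimately have "1 * (?n choose i) \<le> (k choose i) * ?n ^ i"
      by (rule mult_le_mono)
    then show "card {S. S \<subseteq> X \<and> card S = i} \<le> (k choose i) * ?n ^ i"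
      using n_subsets[OF assms] by simp
  qed
  also have "\<dots> = (?n + 1) ^ k"
    using binomial_ring[of ?n 1 k] by simp
  finally show ?thesis .
qed

lemma sauer_shelah:
  assumes "finite X" "F \<subseteq> Pow X"
    and "\<And>S. S \<subseteq> X \<Longrightarrow> shatters F S \<Longrightarrow> card S \<le> k"
  shows "card F \<le> (card X + 1) ^ k"
proof -
  have "card F \<le> card {S. S \<subseteq> X \<and> shatters F S}"
    using assms by (intro card_le_card_shattered)
  also have "\<dots> \<le> card {S. S \<subseteq> X \<and> card S \<le> k}"
    using assms by (intro card_mono) auto
  also have "\<dots> \<le> (card X + 1) ^ k"
    using assms(1) by (rule card_subsets_card_le)
  finally show ?thesis .
qed

section \<open>Halfspaces\<close>

definition halfspace_traces :: "'a::real_inner set \<Rightarrow> 'a set set" where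
  "halfspace_traces P = {{x\<in>P. a \<bullet> x < b} | a b. True}"

text \<open>Radon's theorem splits \<open>DIM('a) + 2\<close> or more points into two parts with
  meeting hulls, but a halfspace cutting out one part would keep the hulls apart.\<close>

lemma halfspace_traces_shatter_card_le:
  fixes P :: "'a::euclidean_space set"
  assumes "finite P" "S \<subseteq> P" "shatters (halfspace_traces P) S"
  shows "card S \<le> DIM('a) + 1"
proof (rule ccontr)
  assume "\<not> card S \<le> DIM('a) + 1"
  moreover have "finite S" using assms finite_subset by blast
  ultimately obtain M N z where MN: "M \<inter> N = {}" "M \<union> N = S"
    and z: "z \<in> convex hull M" "z \<in> convex hull N"
    using affine_dependent_biggerset[of S] Radon_partition[of S] by fastforce
  obtain A where "A \<in> halfspace_traces P" "A \<inter> S = M"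
    using assms(3) MN(2) unfolding shatters_def by blast
  then obtain a b where "{x\<in>P. a \<bullet> x < b} \<inter> S = M"
    unfolding halfspace_traces_def by blast
  then have "M \<subseteq> {x. a \<bullet> x < b}" "N \<subseteq> {x. a \<bullet> x \<ge> b}"
    using MN assms(2) by (auto simp: not_less[symmetric])
  then have "convex hull M \<subseteq> {x. a \<bullet> x < b}" "convex hull N \<subseteq> {x. a \<bullet> x \<ge> b}"
    by (auto intro!: hull_minimal convex_halfspace_lt convex_halfspace_ge del: subsetI)
  with z show False by force
qed

lemma card_halfspace_traces_le:
  fixes P :: "'a::euclidean_space set"
  assumes "finite P"
  shows "card (halfspace_traces P) \<le> (card P + 1) ^ (DIM('a) + 1)"
proof (rule sauer_shelah[OF assms])
  show "halfspace_traces P \<subseteq> Pow P"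
    unfolding halfspace_traces_def by blast
qed (rule halfspace_traces_shatter_card_le[OF assms])

lemma disjoint_hulls_separated:
  fixes A B :: "'a::euclidean_space set"
  assumes "finite A" "finite B" "convex hull A \<inter> convex hull B = {}"
  obtains a b where "\<And>x. x \<in> A \<Longrightarrow> a \<bullet> x < b" "\<And>x. x \<in> B \<Longrightarrow> b < a \<bullet> x"
proof (cases "B = {}")
  case True
  \<comment> \<open>The separation theorem used below wants its compact set nonempty; here the zero
    normal with threshold 1 serves.\<close>
  then show ?thesis using that[of 0 1] by simp
next
  case False
  have "\<exists>a b. (\<forall>x\<in>convex hull A. a \<bullet> x < b) \<and> (\<forall>x\<in>convex hull B. b < a \<bullet> x)"
    using assms False
    by (intro separating_hyperplane_closed_compact)
       (auto simp: compact_imp_closed finite_imp_compact_convex_hull)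
  then show ?thesis using that by (meson hull_inc)
qed

section \<open>Partitions into two parts\<close>

lemma tverberg_partition_two:
  fixes P :: "'a::real_vector set"
  shows "tverberg_partition [s, t] P Q \<longleftrightarrow>
     Q 0 \<inter> Q 1 = {} \<and> Q 0 \<union> Q 1 = P \<and>
     (\<forall>C D. s_convex s C \<and> s_convex t D \<and> Q 0 \<subseteq> C \<and> Q 1 \<subseteq> D \<longrightarrow> C \<inter> D \<noteq> {})"
proof -
  have len: "{..<length [s, t]} = {0, 1}" by auto
  have all2: "(\<forall>i<length [s, t]. R i) \<longleftrightarrow> R 0 \<and> R 1" for R
    by (auto simp: less_Suc_eq)
  have pair: "(\<forall>E. R (E (0::nat)) (E 1)) \<longleftrightarrow> (\<forall>C D. R C D)" for R :: "'a set \<Rightarrow> 'a set \<Rightarrow> bool"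
  proof (intro iffI allI)
    fix C D assume "\<forall>E. R (E (0::nat)) (E 1)"
    from spec[OF this, of "\<lambda>i. if i = 0 then C else D"] show "R C D" by simp
  qed simp
  show ?thesis
    unfolding tverberg_partition_def len all2
    using pair[of "\<lambda>C D. (s_convex s C \<and> Q 0 \<subseteq> C) \<and> s_convex t D \<and> Q 1 \<subseteq> D \<longrightarrow> C \<inter> D \<noteq> {}"]
    by (simp add: disjoint_family_on_def Int_commute conj_ac)
qed

section \<open>Large sets have a Tverberg partition\<close>

text \<open>Failure yields convex sets \<open>K i\<close> covering \<open>A\<close> and
  \<open>L j\<close> covering \<open>P - A\<close>, every \<open>K i\<close> disjoint from every
  \<open>L j\<close>. With \<open>H i j\<close> separating the two on \<open>P\<close>, a point of
  \<open>A\<close> lies, for some \<open>i\<close>, in all \<open>H i j\<close>, while a point of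
  \<open>P - A\<close> lies, for some \<open>j\<close>, in no \<open>H i j\<close>.\<close>

lemma not_tverberg_partition_halfspaces:
  fixes P :: "'a::euclidean_space set"
  assumes "finite P" "A \<subseteq> P" "s \<ge> 1"
    and "\<not> tverberg_partition [s, s] P (\<lambda>i. if i = 0 then A else P - A)"
  obtains H where "\<And>i j. i < s \<Longrightarrow> j < s \<Longrightarrow> H i j \<in> halfspace_traces P"
    "A = (\<Union>i<s. \<Inter>j<s. H i j)"
proof -
  obtain C D where "s_convex s C" "s_convex s D" "A \<subseteq> C" "P - A \<subseteq> D" "C \<inter> D = {}"
    using assms(2,4) unfolding tverberg_partition_two by auto
  then obtain K L where K: "\<And>i. i < s \<Longrightarrow> convex (K i)" "A \<subseteq> (\<Union>i<s. K i)"
    and L: "\<And>j. j < s \<Longrightarrow> convex (L j)" "P - A \<subseteq> (\<Union>j<s. L j)"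
    and KL: "(\<Union>i<s. K i) \<inter> (\<Union>j<s. L j) = {}"
    unfolding s_convex_def by metis
  have "\<exists>a b. (\<forall>x\<in>P \<inter> K i. a \<bullet> x < b) \<and> (\<forall>x\<in>P \<inter> L j. b < a \<bullet> x)" if "i < s" "j < s" for i j
  proof -
    \<comment> \<open>Passing to hulls of finite sets gains compactness, hence strict
      separation.\<close>
    have "convex hull (P \<inter> K i) \<subseteq> K i" "convex hull (P \<inter> L j) \<subseteq> L j"
      using that by (simp_all add: hull_minimal K L)
    then have "convex hull (P \<inter> K i) \<inter> convex hull (P \<inter> L j) = {}"
      using KL that by blast
    then show ?thesis
      using disjoint_hulls_separated[of "P \<inter> K i" "P \<inter> L j"] assms(1) by (metis finite_Int)
  qed
  then obtain a b where ab: "\<And>i j x. i < s \<Longrightarrow> j < s \<Longrightarrow> x \<in> P \<inter> K i \<Longrightarrow> a i j \<bullet> x < b i j"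
    "\<And>i j x. i < s \<Longrightarrow> j < s \<Longrightarrow> x \<in> P \<inter> L j \<Longrightarrow> b i j < a i j \<bullet> x"
    by metis
  define H where "H i j = {x\<in>P. a i j \<bullet> x < b i j}" for i j
  show ?thesis
  proof
    show "H i j \<in> halfspace_traces P" for i j
      by (auto simp: H_def halfspace_traces_def)
    show "A = (\<Union>i<s. \<Inter>j<s. H i j)"
    proof (intro equalityI subsetI)
      fix x assume "x \<in> A"
      then obtain i where "i < s" "x \<in> P \<inter> K i" using K(2) assms(2) by blast
      then show "x \<in> (\<Union>i<s. \<Inter>j<s. H i j)"
        using ab(1) by (auto simp: H_def)
    next
      fix x assume "x \<in> (\<Union>i<s. \<Inter>j<s. H i j)"
      then obtain i where i: "i < s" "\<And>j. j < s \<Longrightarrow> x \<in> H i j" by auto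
      \<comment> \<open>\<open>s \<ge> 1\<close> ensures that the intersection involves an actual
        trace, which confines \<open>x\<close> to \<open>P\<close>.\<close>
      then have "x \<in> P" using \<open>s \<ge> 1\<close> by (auto simp: H_def Suc_le_eq)
      show "x \<in> A"
      proof (rule ccontr)
        assume "x \<notin> A"
        then obtain j where "j < s" "x \<in> P \<inter> L j" using L(2) \<open>x \<in> P\<close> by blast
        then show False using ab(2)[OF i(1), of j x] i(2)[of j] by (simp add: H_def)
      qed
    qed
  qed
qed

text \<open>Each subset of \<open>P\<close> is recovered from an \<open>s\<close> by
  \<open>s\<close> array of halfspace traces, so there are at most as many subsets as
  arrays.\<close>

lemma pow2_card_le_if_no_tverberg_partition:
  fixes P :: "'a::euclidean_space set"
  assumes "finite P" "s \<ge> 1" "\<nexists>Q. tverberg_partition [s, s] P Q"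
  shows "2 ^ card P \<le> (card P + 1) ^ ((DIM('a) + 1) * (s * s))"
proof -
  let ?I = "{..<s} \<times> {..<s}" and ?T = "halfspace_traces P"
  let ?comb = "\<lambda>G. \<Union>i<s. \<Inter>j<s. G (i, j)"
  have finT: "finite ?T"
    by (rule finite_subset[of _ "Pow P"]) (auto simp: halfspace_traces_def assms(1))
  have "Pow P \<subseteq> ?comb ` (?I \<rightarrow>\<^sub>E ?T)"
  proof
    fix A assume "A \<in> Pow P"
    then obtain H where H: "\<And>i j. i < s \<Longrightarrow> j < s \<Longrightarrow> H i j \<in> ?T" "A = (\<Union>i<s. \<Inter>j<s. H i j)"
      using not_tverberg_partition_halfspaces[of P A s] assms by auto
    define G where "G = restrict (\<lambda>(i, j). H i j) ?I"
    have "A = ?comb G" unfolding H(2) by (auto simp: G_def)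
    moreover have "G \<in> ?I \<rightarrow>\<^sub>E ?T" using H(1) by (auto simp: G_def)
    ultimately show "A \<in> ?comb ` (?I \<rightarrow>\<^sub>E ?T)" by blast
  qed
  then have "card (Pow P) \<le> card (?I \<rightarrow>\<^sub>E ?T)"
    using finT by (simp add: surj_card_le finite_PiE)
  also have "\<dots> = card ?T ^ (s * s)" by (simp add: card_PiE)
  also have "\<dots> \<le> ((card P + 1) ^ (DIM('a) + 1)) ^ (s * s)"
    using card_halfspace_traces_le[OF assms(1)] by (intro power_mono) auto
  finally show ?thesis using assms(1) by (simp only: card_Pow power_mult [symmetric])
qed

lemma eventually_power_less_pow2:
  "eventually (\<lambda>n::nat. (n + 1) ^ c < 2 ^ n) at_top"
proof -
  have "eventually (\<lambda>n::nat. (real n + 1) ^ c < 2 ^ n) at_top"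
    by real_asymp
  then show ?thesis
  proof eventually_elim
    case (elim n)
    then have "real ((n + 1) ^ c) < real (2 ^ n)" by (simp add: add.commute)
    then show ?case by (simp only: of_nat_less_iff)
  qed
qed

text \<open>An exponential outgrows a polynomial; one such size suffices for the
  \<open>LEAST\<close> in \<open>tverberg_number\<close> to be attained.\<close>

lemma ex_tverberg_partition:
  assumes "s \<ge> 1"
  shows "\<exists>n. \<forall>P :: 'a::euclidean_space set. finite P \<and> card P = n
           \<longrightarrow> (\<exists>Q. tverberg_partition [s, s] P Q)"
proof -
  obtain n where n: "(n + 1) ^ ((DIM('a) + 1) * (s * s)) < 2 ^ n"
    using eventually_happens[OF eventually_power_less_pow2] by auto
  show ?thesis
  proof (intro exI[of _ n] allI impI)
    fix P :: "'a set" assume "finite P \<and> card P = n"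
    then show "\<exists>Q. tverberg_partition [s, s] P Q"
      using n pow2_card_le_if_no_tverberg_partition[OF _ assms, of P] by fastforce
  qed
qed

section \<open>A planar set without Tverberg partition\<close>

locale touching_grid =
  fixes p :: "nat \<Rightarrow> nat \<Rightarrow> 'a::real_inner" and a :: "nat \<Rightarrow> nat \<Rightarrow> 'a" and s :: nat
  assumes row: "\<lbrakk>i < s; j < s; j' < s; j' \<noteq> j\<rbrakk> \<Longrightarrow> a i j \<bullet> p i j < a i j \<bullet> p i j'"
    and col: "\<lbrakk>i < s; j < s; i' < s; i' \<noteq> i\<rbrakk> \<Longrightarrow> a i j \<bullet> p i' j < a i j \<bullet> p i j"
begin

text \<open>Row \<open>i\<close> and column \<open>j\<close> share only \<open>p i j\<close>, which
  lies in at most one of \<open>R\<close> and \<open>B\<close>. So the hyperplane through it keeps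
  one hull in an open halfspace and the other in the complementary closed one.\<close>

lemma hulls_disjoint:
  assumes "R \<inter> B = {}" "i < s" "j < s"
  shows "convex hull (R \<inter> p i ` {..<s}) \<inter> convex hull (B \<inter> (\<lambda>i. p i j) ` {..<s}) = {}"
proof -
  let ?R = "R \<inter> p i ` {..<s}" and ?B = "B \<inter> (\<lambda>i. p i j) ` {..<s}" and ?b = "a i j \<bullet> p i j"
  note [simp] = convex_halfspace_lt convex_halfspace_gt convex_halfspace_le convex_halfspace_ge
  have R: "x = p i j \<or> ?b < a i j \<bullet> x" if "x \<in> ?R" for x
    using row assms that by auto
  have B: "x = p i j \<or> a i j \<bullet> x < ?b" if "x \<in> ?B" for x
    using col assms that by auto
  show ?thesis
  proof (cases "p i j \<in> R")
    case True
    then have "?R \<subseteq> {x. a i j \<bullet> x \<ge> ?b}" "?B \<subseteq> {x. a i j \<bullet> x < ?b}"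
      using R B assms(1) by fastforce+
    then have "convex hull ?R \<subseteq> {x. a i j \<bullet> x \<ge> ?b}" "convex hull ?B \<subseteq> {x. a i j \<bullet> x < ?b}"
      by (simp_all add: hull_minimal)
    then show ?thesis by force
  next
    case False
    then have "?R \<subseteq> {x. a i j \<bullet> x > ?b}" "?B \<subseteq> {x. a i j \<bullet> x \<le> ?b}"
      using R B by fastforce+
    then have "convex hull ?R \<subseteq> {x. a i j \<bullet> x > ?b}" "convex hull ?B \<subseteq> {x. a i j \<bullet> x \<le> ?b}"
      by (simp_all add: hull_minimal)
    then show ?thesis by force
  qed
qed

lemma inj_on_points: "inj_on (\<lambda>(i, j). p i j) ({..<s} \<times> {..<s})"
proof -
  have False if "i < s" "j < s" "i' < s" "j' < s" "p i j = p i' j'" "(i, j) \<noteq> (i', j')" for i j i' j'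
  proof (cases "i = i' \<or> j = j'")
    case True
    then show ?thesis
      using that row[of i j j'] col[of i j i'] by auto
  next
    case False
    \<comment> \<open>The hyperplane through \<open>p i j'\<close> has \<open>p i j\<close> and
      \<open>p i' j'\<close> strictly on opposite sides.\<close>
    then show ?thesis
      using that row[of i j' j] col[of i j' i'] by auto
  qed
  then show ?thesis by (auto simp: inj_on_def)
qed

lemma no_tverberg_partition:
  assumes "P \<subseteq> (\<lambda>(i, j). p i j) ` ({..<s} \<times> {..<s})"
  shows "\<not> tverberg_partition [s, s] P Q"
proof
  assume T: "tverberg_partition [s, s] P Q"
  have Q: "Q 0 \<inter> Q 1 = {}" "Q 0 \<union> Q 1 = P"
    using T unfolding tverberg_partition_two by blast+
  define K where "K i = convex hull (Q 0 \<inter> p i ` {..<s})" for i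
  define L where "L j = convex hull (Q 1 \<inter> (\<lambda>i. p i j) ` {..<s})" for j
  have "s_convex s (\<Union>i<s. K i)" "s_convex s (\<Union>j<s. L j)"
    unfolding s_convex_def K_def L_def by (metis convex_convex_hull)+
  moreover have "Q 0 \<subseteq> (\<Union>i<s. K i)" "Q 1 \<subseteq> (\<Union>j<s. L j)"
    using Q(2) assms unfolding K_def L_def by (fastforce intro: hull_inc)+
  ultimately have "(\<Union>i<s. K i) \<inter> (\<Union>j<s. L j) \<noteq> {}"
    using T unfolding tverberg_partition_two by blast
  then obtain i j where "i < s" "j < s" "K i \<inter> L j \<noteq> {}"
    by auto
  then show False
    using hulls_disjoint[OF Q(1)] by (auto simp: K_def L_def)
qed

end

text \<open>Slope parameter \<open>t = j / (4 s) < 1/4\<close>: the points of row \<open>i\<close> lie on the convex parabola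
  \<open>2 (x - i)\<^sup>2 - x\<^sup>2\<close> and those of column \<open>j\<close> on the concave parabola \<open>2 t\<^sup>2 - x\<^sup>2\<close>, and the line through
  the point with slope \<open>2 t - 2 i\<close> is tangent to the former and, up to the error \<open>4 t < 1\<close>, to the
  latter.\<close>
lemma ex_touching_grid: "\<exists>(p :: nat \<Rightarrow> nat \<Rightarrow> real ^ 2) a. touching_grid p a s"
proof -
  define t where "t j = real j / (4 * real s)" for j
  define p :: "nat \<Rightarrow> nat \<Rightarrow> real ^ 2"
    where "p i j = vector [real i + t j, 2 * (t j)\<^sup>2 - (real i + t j)\<^sup>2]" for i j
  define a :: "nat \<Rightarrow> nat \<Rightarrow> real ^ 2"
    where "a i j = vector [2 * real i - 2 * t j, 1]" for i j
  have inner: "a i j \<bullet> p i' j' =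
      (2 * real i - 2 * t j) * (real i' + t j') + (2 * (t j')\<^sup>2 - (real i' + t j')\<^sup>2)" for i j i' j'
    by (simp add: a_def p_def inner_vec_def sum_2)
  have "touching_grid p a s"
  proof
    fix i j j' assume "i < s" "j < s" "j' < s" "j' \<noteq> j"
    then have "0 < (t j' - t j)\<^sup>2" by (simp add: t_def)
    also have "\<dots> = a i j \<bullet> p i j' - a i j \<bullet> p i j"
      unfolding inner by (simp add: power2_eq_square algebra_simps)
    finally show "a i j \<bullet> p i j < a i j \<bullet> p i j'" by simp
  next
    fix i j i' assume *: "i < s" "j < s" "i' < s" "i' \<noteq> i"
    define d where "d = real i' - real i"
    have t: "0 \<le> t j" "4 * t j < 1" using * by (auto simp: t_def field_simps)
    \<comment> \<open>Being a nonzero integer, \<open>d\<close> outweighs the error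
      \<open>4 * t j < 1\<close>, so \<open>d\<close> and \<open>d + 4 * t j\<close> have the same
      sign.\<close>
    have "1 \<le> d \<or> d \<le> -1" using *(4) by (auto simp: d_def)
    then have "0 < d * (d + 4 * t j)"
      using t by (auto intro: mult_pos_pos mult_neg_neg)
    also have "\<dots> = a i j \<bullet> p i j - a i j \<bullet> p i' j"
      unfolding inner d_def by (simp add: power2_eq_square algebra_simps)
    finally show "a i j \<bullet> p i' j < a i j \<bullet> p i j" by simp
  qed
  then show ?thesis by blast
qed

theorem theorem1p3:
  fixes s :: nat
  assumes "s \<ge> 1"
  shows "tverberg_number TYPE(2) [s, s] > s ^ 2"
proof -
  obtain p a where "touching_grid (p :: nat \<Rightarrow> nat \<Rightarrow> real ^ 2) a s"
    using ex_touching_grid by blast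
  then interpret touching_grid p a s .
  let ?G = "(\<lambda>(i, j). p i j) ` ({..<s} \<times> {..<s})"
  let ?good = "\<lambda>n. \<forall>P :: (real ^ 2) set. finite P \<and> card P = n
                  \<longrightarrow> (\<exists>Q. tverberg_partition [s, s] P Q)"
  have "card ?G = s ^ 2"
    using inj_on_points by (simp add: card_image power2_eq_square)
  have "\<not> ?good n" if "n \<le> s ^ 2" for n
  proof -
    obtain P where "P \<subseteq> ?G" "card P = n" "finite P"
      using \<open>n \<le> s ^ 2\<close> \<open>card ?G = s ^ 2\<close> by (metis obtain_subset_with_card_n)
    then show ?thesis using no_tverberg_partition by blast
  qed
  moreover have "?good (LEAST n. ?good n)"
    using ex_tverberg_partition[OF assms] by (rule LeastI_ex)
  ultimately show ?thesis
    unfolding tverberg_number_def using not_le by blast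
qed

end
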